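(* Let $G$ be a graph on $n$ vertices with $e(G)$ edges and complement $\overline{G}$. If $e(G)\le \frac{2-\sqrt2}{4}\binom{n}{2}$ or $e(G)\ge\frac{2+\sqrt2}{4}\binom{n}{2}$, then for each $k\in\{1,2,\dots,n-2\}$, $$s_k(G)+s_k(\overline{G})<\binom{n}{2}+2\binom{k+1}{2}.$$
   Context: All graphs are finite, simple and undirected. For a graph $H$ on $n$ vertices, $L(H)=D(H)-A(H)$ is its Laplacian matrix with eigenvalues $\mu_1(H)\ge\dots\ge\mu_n(H)$, and $s_k(H)=\sum_{i=1}^k\mu_i(H)$. $\overline{G}$ denotes the complement of $G$. *)

theory Defs
  imports
    Complex_Main
    "HOL-Library.Countable_Set"
    "Jordan_Normal_Form.Char_Poly"
    "Graph_Theory.Pair_Digraph"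
begin

text \<open>
  Finite simple undirected graphs are the graphs satisfying the locale predicate
  \<^const>\<open>pair_graph\<close>: finite vertex set, and a symmetric irreflexive set of arcs on it.
  Every undirected edge thus occurs as two opposite arcs, so edges have to be counted as
  unordered pairs.
\<close>

definition edge_set :: "'a pair_pre_digraph \<Rightarrow> 'a set set" where
  "edge_set G = {{u, v} | u v. (u, v) \<in> parcs G}"

definition num_edges :: "'a pair_pre_digraph \<Rightarrow> nat" where
  "num_edges G = card (edge_set G)"

definition graph_complement :: "'a pair_pre_digraph \<Rightarrow> 'a pair_pre_digraph" where
  "graph_complement G =
     \<lparr> pverts = pverts G,
       parcs = {(u, v). u \<in> pverts G \<and> v \<in> pverts G \<and> u \<noteq> v \<and> (u, v) \<notin> parcs G} \<rparr>"

lemma pair_graph_complement: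
  assumes "pair_graph G"
  shows "pair_graph (graph_complement G)"
proof -
  interpret pair_graph G by fact
  have "finite (parcs (graph_complement G))"
    by (rule finite_subset[of _ "pverts G \<times> pverts G"])
       (auto simp: graph_complement_def pair_finite_verts)
  moreover have "sym (parcs G)"
    using pair_sym_arcs by (simp add: symmetric_def)
  ultimately show ?thesis
    by unfold_locales
       (auto simp: graph_complement_def pair_finite_verts symmetric_def sym_def)
qed

text \<open>
  Matrices are indexed by \<open>{0..<n}\<close>, so rows and columns refer to the vertices through the
  library enumeration \<^const>\<open>from_nat_into\<close> of the finite vertex set. Another enumeration
  would conjugate the matrices below by a permutation matrix and leave the eigenvalues
  unchanged.
\<close>

definition degree_matrix :: "'a pair_pre_digraph \<Rightarrow> real mat" where
  "degree_matrix G = (let n = card (pverts G); x = from_nat_into (pverts G) in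
     mat n n (\<lambda>(i, j). if i = j then real (out_degree (with_proj G) (x i)) else 0))"

definition adjacency_matrix :: "'a pair_pre_digraph \<Rightarrow> real mat" where
  "adjacency_matrix G = (let n = card (pverts G); x = from_nat_into (pverts G) in
     mat n n (\<lambda>(i, j). if (x i, x j) \<in> parcs G then 1 else 0))"

definition laplacian :: "'a pair_pre_digraph \<Rightarrow> real mat" where
  "laplacian G = degree_matrix G - adjacency_matrix G"

text \<open>
  The eigenvalues, in non-increasing order and repeated according to their multiplicity as
  roots of the characteristic polynomial. The Laplacian of a graph is a real symmetric
  matrix, so all of its \<open>n\<close> complex eigenvalues are real and occur in this list.
\<close>

definition laplacian_eigenvalues :: "'a pair_pre_digraph \<Rightarrow> real list" where
  "laplacian_eigenvalues G = rev (sorted_list_of_multiset (proots (char_poly (laplacian G))))"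

text \<open>The eigenvalues are numbered from 1, list positions from 0.\<close>

definition laplacian_mu :: "'a pair_pre_digraph \<Rightarrow> nat \<Rightarrow> real" where
  "laplacian_mu G i = laplacian_eigenvalues G ! (i - 1)"

definition laplacian_sum :: "nat \<Rightarrow> 'a pair_pre_digraph \<Rightarrow> real" where
  "laplacian_sum k G = (\<Sum>i = 1..k. laplacian_mu G i)"

end

theory Submission
  imports Defs "Jordan_Normal_Form.Schur_Decomposition"
begin

text \<open>
  Let \<open>N = n - 1\<close>, and let \<open>0\<close> and \<open>R\<close> be the Laplacian eigenvalues of \<open>G\<close>, with \<open>R\<close> of size \<open>N\<close>.
  As \<open>L(G) + L(G\<^sup>c) = n I - J\<close>, the complement has the eigenvalues \<open>0\<close> and \<open>n - r\<close> for \<open>r \<in> R\<close>. For every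
  \<open>c \<in> [0, n]\<close> the first sum is at most \<open>k c + \<Sum> max 0 (r - c)\<close> and the second one at most
  \<open>k (n - c) + \<Sum> max 0 (c - r)\<close>, together \<open>k n + \<Sum> \<bar>r - c\<bar>\<close>. Take for \<open>c\<close> the mean \<open>2 e(G) / N\<close>
  of \<open>R\<close>. The variance of \<open>R\<close> is controlled by the traces of \<open>L\<close> and \<open>L\<^sup>2\<close>, hence by the sum of
  the squared degrees, for which de Caen's inequality yields \<open>N \<Sum> (r - c)\<^sup>2 \<le> m n N - 2 m\<^sup>2\<close>
  with \<open>m = e(G)\<close>. The density hypothesis says exactly that the right-hand side is at most
  \<open>n\<^sup>2 N\<^sup>2 / 16\<close>. Therefore \<open>\<Sum> \<bar>r - c\<bar> \<le> n N / 4\<close>, and what remains is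
  \<open>0 < (N / 2 - k)\<^sup>2 + N / 4\<close>.
\<close>

section \<open>Real symmetric matrices\<close>

lemma diag_mult_sum:
  assumes "A \<in> carrier_mat n n" "B \<in> carrier_mat n n"
  shows "sum_list (diag_mat (A * B)) = (\<Sum>i<n. \<Sum>j<n. A $$ (i, j) * B $$ (j, i))"
  using assms
  by (simp add: diag_mat_def scalar_prod_def interv_sum_list_conv_sum_set_nat atLeast0LessThan)

lemma sum_diag_mult_commute:
  fixes A :: "'a :: comm_semiring_1 mat"
  assumes "A \<in> carrier_mat n n" "B \<in> carrier_mat n n"
  shows "sum_list (diag_mat (A * B)) = sum_list (diag_mat (B * A))"
  unfolding diag_mult_sum[OF assms] diag_mult_sum[OF assms(2,1)]
  by (subst sum.swap) (simp add: mult.commute)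

lemma sum_diag_similar:
  fixes A :: "'a :: comm_ring_1 mat"
  assumes "similar_mat_wit A B P Q"
  shows "sum_list (diag_mat A) = sum_list (diag_mat B)"
proof -
  define n where "n = dim_row A"
  note D = similar_mat_witD[OF n_def assms]
  have PB: "P * B \<in> carrier_mat n n" using D(5,6) by simp
  have "sum_list (diag_mat A) = sum_list (diag_mat (Q * (P * B)))"
    unfolding D(3) by (rule sum_diag_mult_commute[OF PB D(7)])
  also have "Q * (P * B) = (Q * P) * B"
    by (rule assoc_mult_mat[OF D(7,6,5), symmetric])
  also have "\<dots> = B"
    using D(2,5) by simp
  finally show ?thesis .
qed

text \<open>Schur decomposition makes \<open>A\<close> similar to an upper triangular
  \<open>B\<close> with diagonal \<open>es\<close>. The trace is invariant under similarity, and the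
  diagonal of \<open>B * B\<close> consists of the squares of the diagonal of
  \<open>B\<close>.\<close>

lemma char_poly_roots_power_sums:
  fixes A :: "real mat"
  assumes A: "A \<in> carrier_mat n n"
    and es: "char_poly A = (\<Prod>e \<leftarrow> es. [:- e, 1:])"
  shows "sum_list es = sum_list (diag_mat A)"
    and "(\<Sum>e \<leftarrow> es. e\<^sup>2) = sum_list (diag_mat (A * A))"
proof -
  obtain B P Q where sd: "schur_decomposition A es = (B, P, Q)"
    by (metis prod_cases3)
  have wit: "similar_mat_wit A B P Q" and ut: "upper_triangular B" and diag: "diag_mat B = es"
    using schur_decomposition[OF A es sd] by auto
  have B: "B \<in> carrier_mat n n"
    using similar_mat_witD2[OF A wit] by auto
  show "sum_list es = sum_list (diag_mat A)"
    using sum_diag_similar[OF wit] diag by simp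
  have "similar_mat_wit (A ^\<^sub>m 2) (B ^\<^sub>m 2) P Q"
    by (rule similar_mat_wit_pow[OF wit])
  then have "sum_list (diag_mat (A * A)) = sum_list (diag_mat (B * B))"
    using sum_diag_similar A B by (simp add: numeral_2_eq_2)
  also have "\<dots> = (\<Sum>i<n. \<Sum>j<n. B $$ (i, j) * B $$ (j, i))"
    by (rule diag_mult_sum[OF B B])
  also have "\<dots> = (\<Sum>i<n. \<Sum>j<n. if j = i then (B $$ (i, i))\<^sup>2 else 0)"
  proof (intro sum.cong refl)
    fix i j assume "i \<in> {..<n}" "j \<in> {..<n}"
    then show "B $$ (i, j) * B $$ (j, i) = (if j = i then (B $$ (i, i))\<^sup>2 else 0)"
      using ut B unfolding upper_triangular_def
      by (cases i j rule: linorder_cases) (auto simp: power2_eq_square)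
  qed
  also have "\<dots> = (\<Sum>e \<leftarrow> diag_mat B. e\<^sup>2)"
    using B by (simp add: diag_mat_def comp_def interv_sum_list_conv_sum_set_nat atLeast0LessThan)
  finally show "(\<Sum>e \<leftarrow> es. e\<^sup>2) = sum_list (diag_mat (A * A))"
    using diag by simp
qed

text \<open>For an eigenvector \<open>v\<close>, the Hermitian form \<open>S\<close> of
  \<open>A\<close> at \<open>v\<close> equals its own conjugate, and it is \<open>e\<close> times
  the positive number \<open>\<Sum> (cmod (v $ i))\<^sup>2\<close>.\<close>

lemma eigenvalue_symmetric_real:
  fixes A :: "real mat"
  assumes A: "A \<in> carrier_mat n n"
    and sym: "\<And>i j. i < n \<Longrightarrow> j < n \<Longrightarrow> A $$ (i, j) = A $$ (j, i)"
    and ev: "eigenvalue (map_mat complex_of_real A) e"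
  shows "e \<in> \<real>"
proof -
  let ?A = "map_mat complex_of_real A"
  obtain v where v: "v \<in> carrier_vec n" "v \<noteq> 0\<^sub>v n" "?A *\<^sub>v v = e \<cdot>\<^sub>v v"
    using ev A unfolding eigenvalue_def eigenvector_def by auto
  define S where "S = (\<Sum>i<n. \<Sum>j<n. cnj (v $ i) * (of_real (A $$ (i, j)) * v $ j))"
  have row: "(\<Sum>j<n. of_real (A $$ (i, j)) * v $ j) = e * v $ i" if "i < n" for i
  proof -
    have "(?A *\<^sub>v v) $ i = e * v $ i" using v that by simp
    then show ?thesis using v(1) A that by (simp add: scalar_prod_def atLeast0LessThan)
  qed
  have "S = (\<Sum>i<n. cnj (v $ i) * (e * v $ i))"
    unfolding S_def by (intro sum.cong refl) (simp add: row flip: sum_distrib_left)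
  also have "\<dots> = e * of_real (\<Sum>i<n. (cmod (v $ i))\<^sup>2)"
    by (simp add: sum_distrib_left complex_norm_square mult_ac del: of_real_power)
  finally have S: "S = e * of_real (\<Sum>i<n. (cmod (v $ i))\<^sup>2)" .
  have "cnj S = (\<Sum>i<n. \<Sum>j<n. v $ i * (of_real (A $$ (i, j)) * cnj (v $ j)))"
    by (simp add: S_def)
  also have "\<dots> = S"
    unfolding S_def by (subst sum.swap) (intro sum.cong refl, simp add: sym mult_ac)
  finally have "S \<in> \<real>" by (simp add: Reals_cnj_iff)
  have "(\<Sum>i<n. (cmod (v $ i))\<^sup>2) \<noteq> 0"
  proof
    assume "(\<Sum>i<n. (cmod (v $ i))\<^sup>2) = 0"
    then have "\<forall>i<n. v $ i = 0" by (subst (asm) sum_nonneg_eq_0_iff) auto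
    then show False using v(1,2) by (auto simp: vec_eq_iff)
  qed
  then have "S / of_real (\<Sum>i<n. (cmod (v $ i))\<^sup>2) = e"
    unfolding S by (simp only: of_real_eq_0_iff nonzero_mult_div_cancel_right not_False_eq_True)
  with \<open>S \<in> \<real>\<close> show ?thesis by (metis Reals_divide Reals_of_real)
qed

text \<open>The characteristic polynomial splits over the complex numbers with real roots only. The
  embedding of real into complex polynomials is injective, so the factorization descends.\<close>

lemma symmetric_char_poly_factorized:
  fixes A :: "real mat"
  assumes A: "A \<in> carrier_mat n n"
    and sym: "\<And>i j. i < n \<Longrightarrow> j < n \<Longrightarrow> A $$ (i, j) = A $$ (j, i)"
  obtains es where "char_poly A = (\<Prod>e \<leftarrow> es. [:- e, 1:])" "length es = n"
proof -
  let ?A = "map_mat complex_of_real A"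
  have A': "?A \<in> carrier_mat n n" using A by simp
  obtain as where as: "char_poly ?A = (\<Prod>a \<leftarrow> as. [:- a, 1:])" "length as = n"
    using char_poly_factorized[OF A'] by auto
  have "a \<in> \<real>" if "a \<in> set as" for a
  proof (rule eigenvalue_symmetric_real[OF A sym])
    have "poly (\<Prod>a \<leftarrow> as. [:- a, 1:]) a = 0"
      using that by (auto simp: poly_prod_list prod_list_zero_iff)
    then show "eigenvalue ?A a"
      using eigenvalue_root_char_poly[OF A'] as by simp
  qed
  then have Re: "map complex_of_real (map Re as) = as"
    by (simp add: map_idI)
  interpret of_real_poly: map_poly_inj_idom_hom complex_of_real ..
  have "map_poly complex_of_real (char_poly A) = char_poly ?A"
    by (rule of_real_hom.char_poly_hom[OF A, symmetric])
  also have "\<dots> = (\<Prod>a \<leftarrow> map complex_of_real (map Re as). [:- a, 1:])"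
    by (simp only: Re as(1))
  also have "\<dots> = map_poly complex_of_real (\<Prod>e \<leftarrow> map Re as. [:- e, 1:])"
    by (simp add: of_real_poly.hom_prod_list comp_def of_real_hom.map_poly_pCons_hom)
  finally have "char_poly A = (\<Prod>e \<leftarrow> map Re as. [:- e, 1:])"
    by (rule of_real_poly.injectivity)
  then show thesis using that[of "map Re as"] as(2) by simp
qed

section \<open>The spectrum of the complement\<close>

text \<open>
  Adding all rows to row \<open>0\<close> makes that row constant, with value \<open>x\<close> or \<open>x - n\<close>; the witness \<open>c\<close> is
  the determinant with this value divided out.
\<close>

lemma det_shift_ones:
  fixes L :: "real mat"
  assumes n: "0 < n"
    and col: "\<And>j. j < n \<Longrightarrow> (\<Sum>i<n. L $$ (i, j)) = 0"
  obtains c where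
    "det (mat n n (\<lambda>(i, j). (if i = j then x else 0) - L $$ (i, j))) = x * c"
    "det (mat n n (\<lambda>(i, j). (if i = j then x else 0) - L $$ (i, j) - 1)) = (x - real n) * c"
proof -
  let ?M = "mat n n (\<lambda>(i, j). (if i = j then x else 0) - L $$ (i, j))"
  let ?N = "mat n n (\<lambda>(i, j). (if i = j then x else 0) - L $$ (i, j) - 1)"
  \<comment> \<open>\<open>K\<close> is the common matrix whose determinant is the witness: row 0 is
    all ones. Multiplying by \<open>U\<close> on the left adds all other rows to row 0; multiplying
    by \<open>W\<close> subtracts row 0 from every other row. Both have determinant 1.\<close>
  define K where "K = mat n n (\<lambda>(i, j). if i = 0 then 1 else (if i = j then x else 0) - L $$ (i, j))"
  define U :: "real mat" where "U = mat n n (\<lambda>(i, j). if i = 0 \<or> i = j then 1 else 0)"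
  define W :: "real mat" where "W = mat n n (\<lambda>(i, j). if i = j then 1 else if j = 0 then - 1 else 0)"
  have car [simp]: "K \<in> carrier_mat n n" "U \<in> carrier_mat n n" "W \<in> carrier_mat n n"
    by (auto simp: K_def U_def W_def)
  have diag: "diag_mat U = replicate n 1" "diag_mat W = replicate n 1"
    by (auto simp: diag_mat_def U_def W_def map_replicate_const intro!: nth_equalityI)
  have "det U = 1"
    using det_upper_triangular[of U n] diag by (simp add: U_def upper_triangular_def)
  have "det W = 1"
    using det_lower_triangular[of n W] diag by (simp add: W_def)
  have colx: "(\<Sum>i<n. (if i = j then x else 0) - L $$ (i, j)) = x"
    and coln: "(\<Sum>i<n. (if i = j then x else 0) - L $$ (i, j) - 1) = x - real n" if "j < n" for j
    using that col[OF that] by (simp_all add: sum_subtractf)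
  have UX: "(U * mat n n f) $$ (i, j) = (if i = 0 then \<Sum>k<n. f (k, j) else f (i, j))"
    if "i < n" "j < n" for f i j
  proof -
    have "(U * mat n n f) $$ (i, j) = (\<Sum>k<n. if i = 0 \<or> k = i then f (k, j) else 0)"
      using that by (auto simp: U_def scalar_prod_def atLeast0LessThan intro!: sum.cong)
    then show ?thesis using that by simp
  qed
  have WK: "(W * K) $$ (i, j) = (if i = 0 then 1 else K $$ (i, j) - 1)" if "i < n" "j < n" for i j
  proof -
    have "(W * K) $$ (i, j) = (\<Sum>k<n. W $$ (i, k) * K $$ (k, j))"
      using that by (simp add: W_def K_def scalar_prod_def atLeast0LessThan)
    also have "\<dots> = (\<Sum>k<n. (if k = i then K $$ (i, j) else 0)
        + (if k = 0 then if i = 0 then 0 else - K $$ (0, j) else 0))"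
      using that by (intro sum.cong) (auto simp: W_def)
    also have "\<dots> = (if i = 0 then 1 else K $$ (i, j) - 1)"
      using that n by (simp add: sum.distrib K_def)
    finally show ?thesis .
  qed
  have "U * ?M = multrow 0 x K"
    by (rule eq_matI) (auto simp: UX colx K_def simp del: index_mult_mat(1), auto simp: U_def)
  then have "det ?M = x * det K"
    using det_mult[of U n ?M] det_multrow[of 0 n K x] n \<open>det U = 1\<close> by simp
  \<comment> \<open>Outside row 0, \<open>?N\<close> is \<open>K\<close> with 1 subtracted from
    every entry, that is, with the all-ones row 0 of \<open>K\<close> subtracted. This is what
    \<open>W\<close> does.\<close>
  moreover have "U * ?N = multrow 0 (x - real n) (W * K)"
  proof (rule eq_matI)
    fix i j assume "i < dim_row (multrow 0 (x - real n) (W * K))"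
      and "j < dim_col (multrow 0 (x - real n) (W * K))"
    then have ij: "i < n" "j < n" by (simp_all add: W_def K_def)
    moreover have "i < dim_row (W * K)" "j < dim_col (W * K)"
      using ij by (simp_all add: W_def K_def)
    moreover have "K $$ (i, j) = (if i = 0 then 1 else (if i = j then x else 0) - L $$ (i, j))"
      using ij by (simp add: K_def)
    ultimately show "(U * ?N) $$ (i, j) = multrow 0 (x - real n) (W * K) $$ (i, j)"
      unfolding UX[OF ij] by (simp add: WK coln del: index_mult_mat)
  qed (simp_all add: U_def W_def K_def)
  then have "det ?N = (x - real n) * det K"
    using det_mult[of U n ?N] det_mult[of W n K] det_multrow[of 0 n "W * K" "x - real n"] n
      mult_carrier_mat[of W n n K n] \<open>det U = 1\<close> \<open>det W = 1\<close> by simp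
  ultimately show thesis using that by blast
qed

lemma poly_char_poly:
  fixes A :: "'a :: field mat"
  assumes "A \<in> carrier_mat n n"
  shows "poly (char_poly A) x = det (mat n n (\<lambda>(i, j). (if i = j then x else 0) - A $$ (i, j)))"
  unfolding char_poly_matrix[OF assms]
  by (rule arg_cong[where f = det]) (use assms in \<open>auto simp: char_matrix_def\<close>)

text \<open>With \<open>y = n - x\<close>, \<open>x I - L' = - (y I - L - J)\<close> for the
  all-ones matrix \<open>J\<close>, so both characteristic polynomials share the cofactor
  \<open>c\<close> of \<open>det_shift_ones\<close> at \<open>y\<close>. The factor
  \<open>x - n\<close> on the left avoids a division and keeps the identity valid at
  \<open>x = n\<close>.\<close>

lemma poly_char_poly_complement:
  fixes L L' :: "real mat"
  assumes L: "L \<in> carrier_mat n n" and L': "L' \<in> carrier_mat n n" and n: "0 < n"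
    and col: "\<And>j. j < n \<Longrightarrow> (\<Sum>i<n. L $$ (i, j)) = 0"
    and compl: "\<And>i j. i < n \<Longrightarrow> j < n \<Longrightarrow>
      L' $$ (i, j) = (if i = j then real n else 0) - 1 - L $$ (i, j)"
  shows "(x - real n) * poly (char_poly L') x = (- 1) ^ n * x * poly (char_poly L) (real n - x)"
    and "poly (char_poly L) 0 = 0"
proof -
  let ?y = "real n - x"
  obtain c where c:
    "det (mat n n (\<lambda>(i, j). (if i = j then ?y else 0) - L $$ (i, j))) = ?y * c"
    "det (mat n n (\<lambda>(i, j). (if i = j then ?y else 0) - L $$ (i, j) - 1)) = (?y - real n) * c"
    by (rule det_shift_ones[OF n col, where x = ?y])
  have "mat n n (\<lambda>(i, j). (if i = j then x else 0) - L' $$ (i, j)) =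
      (- 1) \<cdot>\<^sub>m mat n n (\<lambda>(i, j). (if i = j then ?y else 0) - L $$ (i, j) - 1)"
    by (rule eq_matI) (auto simp: compl)
  then have "poly (char_poly L') x = (- 1) ^ n * ((?y - real n) * c)"
    by (simp add: poly_char_poly[OF L'] c(2))
  moreover have "poly (char_poly L) ?y = ?y * c"
    by (simp add: poly_char_poly[OF L] c(1))
  ultimately show "(x - real n) * poly (char_poly L') x = (- 1) ^ n * x * poly (char_poly L) ?y"
    by (simp only:) (simp add: algebra_simps)
  show "poly (char_poly L) 0 = 0"
    unfolding poly_char_poly[OF L] by (rule det_shift_ones[OF n col, where x = 0]) simp_all
qed

lemma proots_linear_factors:
  fixes es :: "'a :: idom list"
  shows "proots (\<Prod>e \<leftarrow> es. [:- e, 1:]) = mset es"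
proof (induction es)
  case (Cons e es)
  have "(\<Prod>e \<leftarrow> es. [:- e, 1:]) \<noteq> 0" by (auto simp: prod_list_zero_iff)
  then show ?case using Cons by (simp add: proots_mult del: mult_pCons_left)
qed simp

text \<open>The identity of \<open>poly_char_poly_complement\<close> at all points is one of
  polynomials, so root multisets can be compared. The extra root \<open>n\<close> on the left
  cancels against the image of the eigenvalue 0 of \<open>L\<close>.\<close>

lemma proots_char_poly_complement:
  fixes L L' :: "real mat"
  assumes L: "L \<in> carrier_mat n n" and L': "L' \<in> carrier_mat n n" and n: "0 < n"
    and col: "\<And>j. j < n \<Longrightarrow> (\<Sum>i<n. L $$ (i, j)) = 0"
    and compl: "\<And>i j. i < n \<Longrightarrow> j < n \<Longrightarrow>
      L' $$ (i, j) = (if i = j then real n else 0) - 1 - L $$ (i, j)"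
    and es: "char_poly L = (\<Prod>e \<leftarrow> es. [:- e, 1:])"
  obtains R where "mset es = add_mset 0 R"
    "proots (char_poly L') = add_mset 0 (image_mset (\<lambda>r. real n - r) R)"
proof -
  note compl_poly = poly_char_poly_complement[OF L L' n col compl]
  have "0 \<in> set es"
    using compl_poly(2) unfolding es by (auto simp: poly_prod_list prod_list_zero_iff)
  then obtain R where R: "mset es = add_mset 0 R"
    by (metis in_multiset_in_set insert_DiffM)
  let ?q = "\<Prod>e \<leftarrow> map (\<lambda>e. real n - e) es. [:- e, 1:]"
  have "poly ([:- real n, 1:] * char_poly L') x = poly ([:0, 1:] * Polynomial.smult ((- 1) ^ n * (- 1) ^ length es) ?q) x"
    for x
  proof -
    have "poly (char_poly L) (real n - x) = (\<Prod>e \<leftarrow> es. - (x - (real n - e)))"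
      unfolding es by (simp add: poly_prod_list comp_def algebra_simps)
    also have "\<dots> = (- 1) ^ length es * (\<Prod>e \<leftarrow> es. x - (real n - e))"
      by (induction es) (simp_all add: algebra_simps)
    also have "(\<Prod>e \<leftarrow> es. x - (real n - e)) = poly ?q x"
      by (simp add: poly_prod_list comp_def algebra_simps)
    finally show ?thesis using compl_poly(1)[of x] by (simp add: algebra_simps)
  qed
  then have eq: "[:- real n, 1:] * char_poly L' = [:0, 1:] * Polynomial.smult ((- 1) ^ n * (- 1) ^ length es) ?q"
    by (simp only: poly_eq_poly_eq_iff[symmetric] fun_eq_iff) simp
  have ne: "char_poly L' \<noteq> 0" "?q \<noteq> 0"
    using degree_monic_char_poly[OF L'] by (auto simp: prod_list_zero_iff)
  have "add_mset (real n) (proots (char_poly L')) = proots ([:- real n, 1:] * char_poly L')"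
    using ne by (subst proots_mult) auto
  also have "\<dots> = add_mset 0 (image_mset (\<lambda>r. real n - r) (mset es))"
    unfolding eq using ne
    by (subst proots_mult) (simp_all add: proots_linear_factors del: mult_pCons_left map_map)
  finally show thesis using that[OF R] R by simp
qed

section \<open>De Caen's inequality\<close>

text \<open>For a vertex \<open>u\<close>: \<open>D\<close> is its degree, \<open>N = n - 1\<close>,
  \<open>T\<close> counts arcs inside its neighbourhood, \<open>R\<close> counts edges from there to
  the non-neighbours other than \<open>u\<close>, and \<open>M\<close> is the degree sum. The two
  disjunctions carry the integrality of \<open>D\<close> and \<open>N - D\<close>, which gives
  \<open>D (D - 1) \<ge> 0\<close> and \<open>t (t - 1) \<ge> 0\<close>.\<close>

lemma de_caen_vertex_arith:
  fixes N D T R M :: real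
  assumes "2 * D + T + 2 * R \<le> M" "T \<le> D * (D - 1)" "R \<le> D * (N - D)"
    and "0 \<le> R" "D = 0 \<or> 1 \<le> D" "N = D \<or> 1 \<le> N - D"
  shows "N * (D + T + R) \<le> M * D + D * N * (N - 1 - D)"
proof -
  define t where "t = N - D"
  have N: "N = t + D" by (simp add: t_def)
  have D: "0 \<le> D" "0 \<le> D * (D - 1)" and t: "0 \<le> t" "0 \<le> t * (t - 1)"
    using assms(5,6) by (auto simp: t_def)
  have "T * t \<le> D * (D - 1) * t"
    using assms(2) t(1) by (rule mult_right_mono)
  moreover have "(2 * D + T + 2 * R) * D \<le> M * D"
    using assms(1) D(1) by (rule mult_right_mono)
  \<comment> \<open>This remains once the bounds for \<open>M\<close> and \<open>T\<close> are
    inserted. The sign of the coefficient \<open>t - D\<close> decides whether the upper bound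
    \<open>D t\<close> or the lower bound 0 for \<open>R\<close> is used.\<close>
  moreover have "D * (D - 1) * t + R * (t - D) + N * D - 2 * D * D \<le> D * N * (t - 1)"
  proof (cases "D \<le> t")
    case True
    have "R * (t - D) \<le> D * t * (t - D)"
      using assms(3) True by (intro mult_right_mono) (auto simp: t_def)
    moreover have "0 \<le> D * (D - 1) * t"
      using D(2) t(1) by (rule mult_nonneg_nonneg)
    ultimately show ?thesis unfolding N by (simp add: algebra_simps)
  next
    case False
    then have "R * (t - D) \<le> 0"
      using assms(4) by (simp add: mult_nonneg_nonpos)
    moreover have "0 \<le> D * (t * (t - 1))"
      using D(1) t(2) by (rule mult_nonneg_nonneg)
    ultimately show ?thesis unfolding N by (simp add: algebra_simps)
  qed
  ultimately show ?thesis unfolding N by (simp add: algebra_simps)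
qed

text \<open>
  Das' bound \<open>d(u) + m(u) \<le> 2 e(G) / (n - 1) + n - 2\<close>, where \<open>m(u)\<close> is the average degree of the
  neighbours of \<open>u\<close>, with the denominators \<open>d(u)\<close> and \<open>n - 1\<close> cleared. Summing it over \<open>u\<close> gives
  de Caen's inequality.
\<close>

lemma de_caen_vertex:
  fixes a :: "'a \<Rightarrow> 'a \<Rightarrow> real"
  assumes fin: "finite V"
    and bool: "\<And>u v. a u v = 0 \<or> a u v = 1"
    and sym: "\<And>u v. a u v = a v u"
    and irrefl: "\<And>u. a u u = 0"
    and u: "u \<in> V"
  defines "d \<equiv> \<lambda>v. \<Sum>w\<in>V. a v w"
  defines "N \<equiv> real (card V) - 1"
  shows "N * (\<Sum>v\<in>V. a u v * d v) \<le> (\<Sum>v\<in>V. d v) * d u + d u * N * (N - 1 - d u)"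
proof -
  define X where "X = {v \<in> V. a u v = 1}"
  define Y where "Y = V - X - {u}"
  define T where "T = (\<Sum>v\<in>X. \<Sum>w\<in>X. a v w)"
  define R where "R = (\<Sum>v\<in>X. \<Sum>w\<in>Y. a v w)"
  have V: "V = insert u (X \<union> Y)" and disj: "u \<notin> X" "u \<notin> Y" "X \<inter> Y = {}"
    and finXY: "finite X" "finite Y"
    using u fin irrefl by (auto simp: X_def Y_def)
  have split: "sum f V = f u + sum f X + sum f Y" for f :: "'a \<Rightarrow> real"
    unfolding V using disj finXY by (simp add: sum.union_disjoint)
  have nonneg: "0 \<le> a v w" for v w using bool[of v w] by auto
  have le1: "a v w \<le> 1" for v w using bool[of v w] by auto
  have aX: "a u v = 1" if "v \<in> X" for v using that by (simp add: X_def)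
  have aY: "a u v = 0" if "v \<in> Y" for v using that bool[of u v] by (auto simp: X_def Y_def)
  have du: "d u = real (card X)"
    unfolding d_def split by (simp add: irrefl aX aY)
  have cardY: "real (card Y) = N - d u"
  proof -
    have "card V = 1 + card X + card Y"
      unfolding V using disj finXY by (simp add: card_Un_disjoint)
    then show ?thesis by (simp add: N_def du)
  qed
  have dX: "d v = 1 + (\<Sum>w\<in>X. a v w) + (\<Sum>w\<in>Y. a v w)" if "v \<in> X" for v
    unfolding d_def split using aX[OF that] sym[of u v] by simp
  have S: "(\<Sum>v\<in>X. d v) = d u + T + R"
    by (simp add: dX du T_def R_def sum.distrib)
  have "(\<Sum>v\<in>V. a u v * d v) = d u + T + R"
    unfolding split using S by (simp add: irrefl aX aY)
  moreover have "N * (d u + T + R) \<le> (\<Sum>v\<in>V. d v) * d u + d u * N * (N - 1 - d u)"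
  proof (rule de_caen_vertex_arith)
    \<comment> \<open>Counted from the side of \<open>Y\<close>, \<open>R\<close> is at most the
      degree sum over \<open>Y\<close>. The degree sum over \<open>V\<close> adds \<open>d u\<close>
      from \<open>u\<close> and \<open>d u + T + R\<close> from \<open>X\<close>.\<close>
    have "R = (\<Sum>v\<in>Y. \<Sum>w\<in>X. a v w)"
      unfolding R_def by (subst sum.swap) (simp add: sym)
    also have "\<dots> \<le> (\<Sum>v\<in>Y. d v)"
      unfolding d_def using fin by (intro sum_mono sum_mono2) (auto simp: X_def nonneg)
    finally show "2 * d u + T + 2 * R \<le> (\<Sum>v\<in>V. d v)"
      unfolding split[of d] S by simp
    have "(\<Sum>w\<in>X. a v w) \<le> d u - 1" if "v \<in> X" for v
    proof -
      have "(\<Sum>w\<in>X. a v w) = (\<Sum>w\<in>X - {v}. a v w)"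
        using that finXY by (simp add: sum.remove irrefl)
      also have "\<dots> \<le> (\<Sum>w\<in>X - {v}. 1)"
        by (intro sum_mono le1)
      also have "\<dots> = d u - 1"
        using that finXY card_gt_0_iff[of X] by (auto simp: du of_nat_diff)
      finally show ?thesis .
    qed
    then show "T \<le> d u * (d u - 1)"
      unfolding T_def using sum_bounded_above[of X "\<lambda>v. \<Sum>w\<in>X. a v w" "d u - 1"] by (simp add: du)
    have "(\<Sum>w\<in>Y. a v w) \<le> N - d u" for v
      using sum_bounded_above[of Y "a v" 1] le1 by (simp add: cardY)
    then show "R \<le> d u * (N - d u)"
      unfolding R_def using sum_bounded_above[of X "\<lambda>v. \<Sum>w\<in>Y. a v w" "N - d u"] by (simp add: du)
    show "0 \<le> R" by (simp add: R_def sum_nonneg nonneg)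
    show "d u = 0 \<or> 1 \<le> d u" by (cases "card X") (simp_all add: du)
    show "N = d u \<or> 1 \<le> N - d u" unfolding cardY[symmetric] 
      using cardY by (cases "card Y") simp_all
  qed
  ultimately show ?thesis by simp
qed

text \<open>Summing the neighbour degrees over all vertices counts each \<open>d v\<close> exactly
  \<open>d v\<close> times. With degree sum \<open>2 m\<close>, division by \<open>2 N\<close> gives
  the usual form \<open>\<Sum> (d v)\<^sup>2 \<le> m (2 m / (n - 1) + n - 2)\<close>.\<close>

lemma de_caen:
  fixes a :: "'a \<Rightarrow> 'a \<Rightarrow> real"
  assumes fin: "finite V"
    and bool: "\<And>u v. a u v = 0 \<or> a u v = 1"
    and sym: "\<And>u v. a u v = a v u"
    and irrefl: "\<And>u. a u u = 0"
  defines "d \<equiv> \<lambda>v. \<Sum>w\<in>V. a v w"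
  defines "N \<equiv> real (card V) - 1"
  shows "2 * N * (\<Sum>v\<in>V. (d v)\<^sup>2) \<le> (\<Sum>v\<in>V. d v)\<^sup>2 + (\<Sum>v\<in>V. d v) * N * (N - 1)"
proof -
  let ?M = "\<Sum>v\<in>V. d v"
  have "(\<Sum>u\<in>V. \<Sum>v\<in>V. a u v * d v) = (\<Sum>v\<in>V. (d v)\<^sup>2)"
    by (subst sum.swap) (simp add: d_def sym power2_eq_square flip: sum_distrib_right)
  then have "N * (\<Sum>v\<in>V. (d v)\<^sup>2) = (\<Sum>u\<in>V. N * (\<Sum>v\<in>V. a u v * d v))"
    by (simp flip: sum_distrib_left)
  also have "\<dots> \<le> (\<Sum>u\<in>V. ?M * d u + d u * N * (N - 1 - d u))"
    unfolding d_def N_def by (intro sum_mono de_caen_vertex assms)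
  also have "\<dots> = (\<Sum>u\<in>V. ?M * d u + (N * (N - 1)) * d u - N * (d u)\<^sup>2)"
    by (simp add: algebra_simps power2_eq_square)
  also have "\<dots> = ?M\<^sup>2 + ?M * N * (N - 1) - N * (\<Sum>v\<in>V. (d v)\<^sup>2)"
    by (simp only: sum.distrib sum_subtractf sum_distrib_left[symmetric])
      (simp add: power2_eq_square)
  finally show ?thesis by simp
qed

section \<open>Laplacian eigenvalue sums\<close>

text \<open>Each entry is at most \<open>c\<close> plus its positive excess over \<open>c\<close>;
  the excesses beyond the prefix are nonnegative.\<close>

lemma sum_prefix_le:
  fixes xs :: "real list"
  assumes "k \<le> length xs"
  shows "(\<Sum>i<k. xs ! i) \<le> real k * c + (\<Sum>x\<in>#mset xs. max 0 (x - c))"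
proof -
  have "(\<Sum>i<k. xs ! i) \<le> (\<Sum>i<k. c + max 0 (xs ! i - c))"
    by (rule sum_mono) simp
  also have "\<dots> = real k * c + (\<Sum>i<k. max 0 (xs ! i - c))"
    by (simp add: sum.distrib)
  also have "(\<Sum>i<k. max 0 (xs ! i - c)) \<le> (\<Sum>i<length xs. max 0 (xs ! i - c))"
    using assms by (intro sum_mono2) auto
  also have "\<dots> = (\<Sum>x \<leftarrow> xs. max 0 (x - c))"
    by (simp add: sum_list_sum_nth atLeast0LessThan)
  also have "\<dots> = (\<Sum>x\<in>#mset xs. max 0 (x - c))"
    by (metis mset_map sum_mset_sum_list)
  finally show ?thesis by simp
qed

text \<open>A mean square of at most \<open>b\<^sup>2\<close> bounds the mean absolute deviation by
  \<open>b\<close>: sum \<open>2 b \<bar>x\<bar> \<le> x\<^sup>2 + b\<^sup>2\<close> over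
  \<open>R\<close>.\<close>

lemma sum_mset_abs_le:
  fixes R :: "real multiset"
  assumes b: "0 < b" and sq: "(\<Sum>r\<in>#R. (r - c)\<^sup>2) \<le> real (size R) * b\<^sup>2"
  shows "(\<Sum>r\<in>#R. \<bar>r - c\<bar>) \<le> real (size R) * b"
proof -
  have "2 * b * \<bar>x\<bar> \<le> x\<^sup>2 + b\<^sup>2" for x :: real
    using sum_squares_bound[of "\<bar>x\<bar>" b] by (simp add: mult_ac)
  then have "(\<Sum>r\<in>#R. 2 * b * \<bar>r - c\<bar>) \<le> (\<Sum>r\<in>#R. (r - c)\<^sup>2 + b\<^sup>2)"
    by (intro sum_mset_mono) simp
  then have "2 * b * (\<Sum>r\<in>#R. \<bar>r - c\<bar>) \<le> (\<Sum>r\<in>#R. (r - c)\<^sup>2) + real (size R) * b\<^sup>2"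
    by (simp only: sum_mset.distrib sum_mset_distrib_left[symmetric]) simp
  also have "\<dots> \<le> real (size R) * b\<^sup>2 + real (size R) * b\<^sup>2"
    using sq by simp
  also have "\<dots> = 2 * b * (real (size R) * b)"
    by (simp add: power2_eq_square)
  finally show ?thesis by (rule mult_left_le_imp_le) (use b in simp)
qed

lemma real_choose_two: "real (n choose 2) = real n * (real n - 1) / 2"
proof (cases n)
  case (Suc m)
  then show ?thesis
    unfolding choose_two by (subst real_of_nat_div) (auto simp: algebra_simps)
qed simp

lemma laplacian_sum_le:
  assumes "k \<le> size (proots (char_poly (laplacian G)))"
  shows "laplacian_sum k G \<le>
    real k * c + (\<Sum>x\<in>#proots (char_poly (laplacian G)). max 0 (x - c))"
proof -
  have "mset (laplacian_eigenvalues G) = proots (char_poly (laplacian G))"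
    by (simp add: laplacian_eigenvalues_def)
  moreover from this have "k \<le> length (laplacian_eigenvalues G)"
    using assms by (metis size_mset)
  moreover have "laplacian_sum k G = (\<Sum>i<k. laplacian_eigenvalues G ! i)"
    unfolding laplacian_sum_def laplacian_mu_def
    by (rule sum.reindex_bij_witness[of _ Suc "\<lambda>i. i - 1"]) auto
  ultimately show ?thesis
    using sum_prefix_le[of k "laplacian_eigenvalues G" c] by simp
qed

section \<open>Degrees, traces and eigenvalues of graph Laplacians\<close>

definition adj :: "'a pair_pre_digraph \<Rightarrow> 'a \<Rightarrow> 'a \<Rightarrow> real" where
  "adj G u v = of_bool ((u, v) \<in> parcs G)"

definition deg :: "'a pair_pre_digraph \<Rightarrow> 'a \<Rightarrow> real" where
  "deg G u = (\<Sum>v\<in>pverts G. adj G u v)"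

lemma graph_complement_pverts [simp]: "pverts (graph_complement G) = pverts G"
  by (simp add: graph_complement_def)

lemma adj_complement:
  assumes "pair_graph G" "u \<in> pverts G" "v \<in> pverts G"
  shows "adj (graph_complement G) u v = 1 - of_bool (u = v) - adj G u v"
proof -
  interpret pair_graph G by fact
  show ?thesis
    using assms(2,3) pair_no_loops[of "(u, u)"] by (auto simp: adj_def graph_complement_def)
qed

context pair_graph
begin

lemma adj_sym: "adj G u v = adj G v u"
  using arcs_symmetric by (auto simp: adj_def)

lemma adj_irrefl [simp]: "adj G u u = 0"
  using pair_no_loops[of "(u, u)"] by (auto simp: adj_def)

lemma adj_cases: "adj G u v = 0 \<or> adj G u v = 1"
  by (simp add: adj_def)

lemma out_degree_eq_deg: "real (out_degree (with_proj G) u) = deg G u"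
proof -
  have "out_arcs (with_proj G) u = Pair u ` {v \<in> pverts G. (u, v) \<in> parcs G}"
    using wellformed' by (auto simp: out_arcs_def)
  then have "out_degree (with_proj G) u = card {v \<in> pverts G. (u, v) \<in> parcs G}"
    by (simp add: out_degree_def card_image inj_on_def)
  then show ?thesis
    using pair_finite_verts by (simp add: deg_def adj_def sum.If_cases of_bool_def Int_def)
qed

text \<open>Handshake lemma: the degree sum counts arcs, and each unordered edge comes from exactly
  two arcs because there are no loops.\<close>

lemma sum_deg: "(\<Sum>u\<in>pverts G. deg G u) = 2 * real (num_edges G)"
proof -
  let ?e = "\<lambda>(u, v). {u, v}"
  have img: "edge_set G = ?e ` parcs G"
    by (auto simp: edge_set_def)
  have fibre: "card {p \<in> parcs G. ?e p = y} = 2" if y: "y \<in> ?e ` parcs G" for y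
  proof -
    obtain p where "y = ?e p" "p \<in> parcs G" using y by (rule imageE)
    then obtain u v where uv: "(u, v) \<in> parcs G" "y = {u, v}" by (cases p) simp
    then have "{p \<in> parcs G. ?e p = y} = {(u, v), (v, u)}"
      using arcs_symmetric by (auto simp: doubleton_eq_iff)
    moreover have "u \<noteq> v" using pair_no_loops uv(1) by fastforce
    ultimately show ?thesis by simp
  qed
  have "card (parcs G) = (\<Sum>y\<in>?e ` parcs G. card {p \<in> parcs G. ?e p = y})"
    using sum.image_gen[OF pair_finite_arcs, of "\<lambda>_. 1 :: nat" ?e] by simp
  also have "\<dots> = 2 * num_edges G"
    using fibre by (simp add: num_edges_def img)
  finally have card: "card (parcs G) = 2 * num_edges G" .
  have "(\<Sum>u\<in>pverts G. deg G u) = (\<Sum>p\<in>pverts G \<times> pverts G. of_bool (p \<in> parcs G))"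
    by (simp only: deg_def adj_def sum.cartesian_product split_def prod.collapse)
  also have "\<dots> = real (card (parcs G))"
  proof -
    have "pverts G \<times> pverts G \<inter> parcs G = parcs G"
      by (auto dest: in_arcsD1 in_arcsD2)
    then show ?thesis
      using pair_finite_verts by (simp add: of_bool_def sum.If_cases)
  qed
  finally show ?thesis using card by simp
qed

lemma deg_le: "u \<in> pverts G \<Longrightarrow> deg G u \<le> real (card (pverts G)) - 1"
proof -
  assume u: "u \<in> pverts G"
  have "deg G u = (\<Sum>v\<in>pverts G - {u}. adj G u v)"
    unfolding deg_def using pair_finite_verts u by (simp add: sum.remove)
  also have "\<dots> \<le> (\<Sum>v\<in>pverts G - {u}. 1)"
    by (intro sum_mono) (simp add: adj_def)
  also have "\<dots> = real (card (pverts G)) - 1"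
    using pair_finite_verts u card_gt_0_iff[of "pverts G"] by (auto simp: of_nat_diff)
  finally show ?thesis .
qed

lemma laplacian_carrier: "laplacian G \<in> carrier_mat (card (pverts G)) (card (pverts G))"
  unfolding laplacian_def degree_matrix_def adjacency_matrix_def Let_def
  by (intro minus_carrier_mat mat_carrier)

lemma laplacian_entry:
  assumes "i < card (pverts G)" "j < card (pverts G)"
  shows "laplacian G $$ (i, j) = (if i = j then deg G (from_nat_into (pverts G) i) else 0)
    - adj G (from_nat_into (pverts G) i) (from_nat_into (pverts G) j)"
  using assms by (simp add: laplacian_def degree_matrix_def adjacency_matrix_def Let_def
      out_degree_eq_deg adj_def)

lemma sum_enum: "(\<Sum>i<card (pverts G). f (from_nat_into (pverts G) i)) = (\<Sum>v\<in>pverts G. f v)"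
  by (rule sum.reindex_bij_betw[OF bij_betw_from_nat_into_finite[OF pair_finite_verts]])

lemma laplacian_col_sum:
  assumes "j < card (pverts G)"
  shows "(\<Sum>i<card (pverts G). laplacian G $$ (i, j)) = 0"
  using assms sum_enum[of "\<lambda>v. adj G v (from_nat_into (pverts G) j)"]
  by (simp add: laplacian_entry sum_subtractf deg_def adj_sym[of "from_nat_into (pverts G) j"])

lemma laplacian_trace: "sum_list (diag_mat (laplacian G)) = (\<Sum>v\<in>pverts G. deg G v)"
proof -
  have "sum_list (diag_mat (laplacian G)) = (\<Sum>i<card (pverts G). laplacian G $$ (i, i))"
    using laplacian_carrier
    by (simp add: diag_mat_def interv_sum_list_conv_sum_set_nat atLeast0LessThan)
  also have "\<dots> = (\<Sum>v\<in>pverts G. deg G v)"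
    by (simp add: laplacian_entry sum_enum)
  finally show ?thesis .
qed

text \<open>By symmetry the trace is the sum of all squared entries. The diagonal gives the squared
  degrees; the off-diagonal entries are 0 or -1, and their squares in a row add up to the
  degree.\<close>

lemma laplacian_trace_square:
  "sum_list (diag_mat (laplacian G * laplacian G)) =
    (\<Sum>v\<in>pverts G. (deg G v)\<^sup>2) + (\<Sum>v\<in>pverts G. deg G v)"
proof -
  let ?n = "card (pverts G)" and ?x = "from_nat_into (pverts G)"
  have "sum_list (diag_mat (laplacian G * laplacian G)) =
      (\<Sum>i<?n. \<Sum>j<?n. laplacian G $$ (i, j) * laplacian G $$ (j, i))"
    by (rule diag_mult_sum[OF laplacian_carrier laplacian_carrier])
  also have "\<dots> = (\<Sum>i<?n. \<Sum>j<?n. (if j = i then (deg G (?x i))\<^sup>2 else 0) + adj G (?x i) (?x j))"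
  proof (intro sum.cong refl)
    fix i j assume ij: "i \<in> {..<?n}" "j \<in> {..<?n}"
    have "adj G (?x i) (?x j) * adj G (?x j) (?x i) = adj G (?x i) (?x j)"
      unfolding adj_sym[of "?x j"] using adj_cases[of "?x i" "?x j"] by auto
    then show "laplacian G $$ (i, j) * laplacian G $$ (j, i) =
        (if j = i then (deg G (?x i))\<^sup>2 else 0) + adj G (?x i) (?x j)"
      using ij by (simp add: laplacian_entry power2_eq_square)
  qed
  also have "\<dots> = (\<Sum>i<?n. (deg G (?x i))\<^sup>2 + deg G (?x i))"
    by (simp add: sum.distrib sum_enum deg_def)
  also have "\<dots> = (\<Sum>v\<in>pverts G. (deg G v)\<^sup>2 + deg G v)"
    by (rule sum_enum)
  finally show ?thesis by (simp add: sum.distrib)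
qed

lemma laplacian_complement_entry:
  assumes "i < card (pverts G)" "j < card (pverts G)"
  shows "laplacian (graph_complement G) $$ (i, j) =
    (if i = j then real (card (pverts G)) else 0) - 1 - laplacian G $$ (i, j)"
proof -
  have G: "pair_graph G" by unfold_locales
  interpret C: pair_graph "graph_complement G" by (rule pair_graph_complement[OF G])
  let ?x = "from_nat_into (pverts G)"
  have x: "?x i \<in> pverts G" "?x j \<in> pverts G"
    using assms by (auto intro!: from_nat_into simp: card_gt_0_iff)
  have inj: "?x i = ?x j \<longleftrightarrow> i = j"
    using bij_betw_from_nat_into_finite[OF pair_finite_verts] assms
    by (auto simp: bij_betw_def inj_on_eq_iff)
  have "deg (graph_complement G) (?x i) = (\<Sum>v\<in>pverts G. 1 - of_bool (?x i = v) - adj G (?x i) v)"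
    unfolding deg_def using adj_complement[OF G x(1)] by simp
  also have "\<dots> = real (card (pverts G)) - 1 - deg G (?x i)"
    using x pair_finite_verts by (simp add: sum_subtractf deg_def of_bool_def)
  finally show ?thesis
    using assms adj_complement[OF G x]
    by (auto simp add: C.laplacian_entry laplacian_entry inj)
qed

text \<open>\<open>R\<close> is the spectrum of \<open>G\<close> with one 0 removed. Cutting at
  \<open>c\<close> for \<open>G\<close> and at \<open>n - c\<close> for the complement makes the two
  excesses of \<open>r\<close> the positive and negative parts of \<open>r - c\<close>. The bounds
  on \<open>c\<close> ensure that the removed eigenvalue 0 adds no excess on either side.\<close>

lemma laplacian_sum_add_complement_le:
  assumes nonempty: "pverts G \<noteq> {}" and k: "k \<le> card (pverts G)"
    and c: "0 \<le> c" "c \<le> real (card (pverts G))"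
  obtains R where
    "laplacian_sum k G + laplacian_sum k (graph_complement G)
      \<le> real k * real (card (pverts G)) + (\<Sum>r\<in>#R. \<bar>r - c\<bar>)"
    "size R = card (pverts G) - 1"
    "(\<Sum>r\<in>#R. r) = (\<Sum>v\<in>pverts G. deg G v)"
    "(\<Sum>r\<in>#R. r\<^sup>2) = (\<Sum>v\<in>pverts G. (deg G v)\<^sup>2) + (\<Sum>v\<in>pverts G. deg G v)"
proof -
  let ?n = "card (pverts G)" and ?L = "laplacian G" and ?L' = "laplacian (graph_complement G)"
  have n: "0 < ?n" using nonempty pair_finite_verts by (simp add: card_gt_0_iff)
  interpret C: pair_graph "graph_complement G"
    by (rule pair_graph_complement) unfold_locales
  have L': "?L' \<in> carrier_mat ?n ?n" using C.laplacian_carrier by simp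
  have sym: "?L $$ (i, j) = ?L $$ (j, i)" if "i < ?n" "j < ?n" for i j
    using that by (simp add: laplacian_entry adj_sym)
  obtain es where es: "char_poly ?L = (\<Prod>e \<leftarrow> es. [:- e, 1:])" "length es = ?n"
    using symmetric_char_poly_factorized[OF laplacian_carrier sym] by blast
  obtain R where R: "mset es = add_mset 0 R"
      "proots (char_poly ?L') = add_mset 0 (image_mset (\<lambda>r. real ?n - r) R)"
    using proots_char_poly_complement[OF laplacian_carrier L' n laplacian_col_sum
        laplacian_complement_entry es(1)] by blast
  have proots: "proots (char_poly ?L) = add_mset 0 R"
    by (simp add: es(1) proots_linear_factors R(1))
  have size: "size R = ?n - 1" "size (add_mset 0 R) = ?n"
    using es(2) R(1) by (metis size_mset size_add_mset diff_Suc_1) (metis es(2) R(1) size_mset)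
  have "laplacian_sum k G \<le> real k * c + (\<Sum>r\<in>#R. max 0 (r - c))"
    using laplacian_sum_le[of k G c] k size c unfolding proots by simp
  moreover have "laplacian_sum k (graph_complement G)
      \<le> real k * (real ?n - c) + (\<Sum>r\<in>#R. max 0 (c - r))"
    using laplacian_sum_le[of k "graph_complement G" "real ?n - c"] k size c
    unfolding R(2) by (simp add: multiset.map_comp comp_def)
  moreover have "(\<Sum>r\<in>#R. max 0 (r - c)) + (\<Sum>r\<in>#R. max 0 (c - r)) = (\<Sum>r\<in>#R. \<bar>r - c\<bar>)"
    unfolding sum_mset.distrib[symmetric]
    by (rule arg_cong[where f = sum_mset]) (rule image_mset_cong, simp add: max_def abs_if)
  ultimately have le: "laplacian_sum k G + laplacian_sum k (graph_complement G)
      \<le> real k * real ?n + (\<Sum>r\<in>#R. \<bar>r - c\<bar>)"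
    by (simp add: algebra_simps)
  \<comment> \<open>The removed eigenvalue 0 is invisible to both power sums, so the trace formulas
    for \<open>es\<close> carry over to \<open>R\<close>.\<close>
  have "(\<Sum>r\<in>#R. f r) = (\<Sum>e \<leftarrow> es. f e)" if "f 0 = 0" for f :: "real \<Rightarrow> real"
  proof -
    have "(\<Sum>e \<leftarrow> es. f e) = (\<Sum>e\<in>#mset es. f e)"
      by (metis mset_map sum_mset_sum_list)
    then show ?thesis using that by (simp add: R(1))
  qed
  from this[of "\<lambda>r. r"] this[of "\<lambda>r. r\<^sup>2"] show thesis
    using char_poly_roots_power_sums[OF laplacian_carrier es(1)]
    by (intro that[OF le size(1)]) (simp_all add: laplacian_trace laplacian_trace_square)
qed

end

theorem theorem3p8:
  fixes G :: "'a pair_pre_digraph" and n k :: nat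
  assumes "pair_graph G"
    and "card (pverts G) = n"
    and "real (num_edges G) \<le> (2 - sqrt 2) / 4 * real (n choose 2) \<or>
         real (num_edges G) \<ge> (2 + sqrt 2) / 4 * real (n choose 2)"
    and "k \<in> {1..n - 2}"
  shows "laplacian_sum k G + laplacian_sum k (graph_complement G)
         < real (n choose 2) + 2 * real ((k + 1) choose 2)"
proof -
  interpret pair_graph G by fact
  define N where "N = real n - 1"
  define M where "M = (\<Sum>v\<in>pverts G. deg G v)"
  define Q where "Q = (\<Sum>v\<in>pverts G. (deg G v)\<^sup>2)"
  define c where "c = M / N"
  have n3: "3 \<le> n" using assms(4) by auto
  then have N: "2 \<le> N" "real n = N + 1" by (simp_all add: N_def)
  have "0 \<le> M" unfolding M_def sum_deg by simp
  \<comment> \<open>This yields \<open>c \<le> n\<close>, so that the mean is an admissible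
    cut.\<close>
  have "M \<le> real n * N"
    unfolding M_def using sum_bounded_above[of "pverts G" "deg G" N] deg_le assms(2)
    by (simp add: N_def)
  then have c: "0 \<le> c" "c \<le> real n" "c * N = M"
    using \<open>0 \<le> M\<close> N(1) by (simp_all add: c_def field_simps)
  have de_Caen: "2 * N * Q \<le> M\<^sup>2 + M * N * (N - 1)"
    unfolding M_def Q_def N_def assms(2)[symmetric] deg_def
    by (rule de_caen[OF pair_finite_verts adj_cases adj_sym adj_irrefl])
  \<comment> \<open>The quadratic in \<open>M\<close> has the roots
    \<open>(2 - sqrt 2) / 4 * ?b\<close> and \<open>(2 + sqrt 2) / 4 * ?b\<close>. As
    \<open>M\<close> is twice the edge number and \<open>?b\<close> twice the binomial coefficient,
    the hypothesis places \<open>M\<close> outside the open interval between them.\<close>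
  have density: "0 \<le> M\<^sup>2 - M * (N * real n) + (N * real n)\<^sup>2 / 8"
  proof -
    let ?b = "N * real n"
    have "M \<le> (2 - sqrt 2) / 4 * ?b \<or> (2 + sqrt 2) / 4 * ?b \<le> M"
      using assms(3) unfolding M_def sum_deg real_choose_two N_def by (simp add: mult_ac)
    moreover have "(2 - sqrt 2) / 4 * ?b \<le> (2 + sqrt 2) / 4 * ?b"
      using N by (intro mult_right_mono) auto
    ultimately have "0 \<le> (M - (2 - sqrt 2) / 4 * ?b) * (M - (2 + sqrt 2) / 4 * ?b)"
      by (auto simp: zero_le_mult_iff)
    also have "\<dots> = M\<^sup>2 - M * ?b + (4 - (sqrt 2)\<^sup>2) / 16 * ?b\<^sup>2"
      by (simp add: power2_eq_square field_simps)
    finally show ?thesis by simp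
  qed
  obtain R where R:
    "laplacian_sum k G + laplacian_sum k (graph_complement G)
      \<le> real k * real n + (\<Sum>r\<in>#R. \<bar>r - c\<bar>)"
    "size R = n - 1" "(\<Sum>r\<in>#R. r) = M" "(\<Sum>r\<in>#R. r\<^sup>2) = Q + M"
    using laplacian_sum_add_complement_le[of k c] assms(2,4) n3 c unfolding M_def Q_def
    by force
  have sizeR: "real (size R) = N" using R(2) n3 by (simp add: N_def)
  have "(\<Sum>r\<in>#R. (r - c)\<^sup>2) = (\<Sum>r\<in>#R. r\<^sup>2 + (c\<^sup>2 + (- 2 * c) * r))"
    by (simp add: power2_diff algebra_simps)
  also have "\<dots> = Q + M + (N * c\<^sup>2 + (- 2 * c) * M)"
    unfolding sum_mset.distrib sum_mset_distrib_left[symmetric] R(3,4) by (simp add: sizeR)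
  also have "\<dots> = Q + M - c * M"
    using c(3) by (simp add: power2_eq_square algebra_simps)
  finally have var: "(\<Sum>r\<in>#R. (r - c)\<^sup>2) = Q + M - c * M" .
  \<comment> \<open>The factor \<open>2 * N\<close> clears the denominator of \<open>c\<close> and
    matches the left side of de Caen's inequality.\<close>
  have "2 * N * (Q + M - c * M) = 2 * N * Q + 2 * N * M - 2 * (c * N) * M"
    by (simp add: algebra_simps)
  also have "\<dots> = 2 * N * Q + 2 * N * M - 2 * M * M"
    by (simp only: c(3))
  also have "\<dots> \<le> M * (N * real n) - M\<^sup>2"
    using de_Caen by (simp add: N(2) power2_eq_square algebra_simps)
  also have "\<dots> \<le> (N * real n)\<^sup>2 / 8"
    using density by linarith
  also have "\<dots> = 2 * N * (N * (real n / 4)\<^sup>2)"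
    by (simp add: power2_eq_square)
  finally have "Q + M - c * M \<le> N * (real n / 4)\<^sup>2"
    using N(1) by simp
  then have "(\<Sum>r\<in>#R. \<bar>r - c\<bar>) \<le> real (size R) * (real n / 4)"
    using n3 by (intro sum_mset_abs_le) (simp_all add: var sizeR)
  then have "laplacian_sum k G + laplacian_sum k (graph_complement G)
      \<le> real k * real n + N * (real n / 4)"
    using R(1) by (simp add: sizeR)
  also have "\<dots> < N * real n / 2 + real k * (real k + 1)"
  proof -
    \<comment> \<open>This is exactly the right side minus the left side after substituting
      \<open>n = N + 1\<close>; the strictness comes from \<open>N / 4\<close>.\<close>
    have "0 < (N / 2 - real k)\<^sup>2 + N / 4"
      using N(1) by (simp add: add_nonneg_pos)
    then show ?thesis by (simp add: N(2) power2_eq_square field_simps)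
  qed
  also have "\<dots> = real (n choose 2) + 2 * real ((k + 1) choose 2)"
    by (simp add: real_choose_two N_def algebra_simps del: One_nat_def)
  finally show ?thesis .
qed

end
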